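(* For every (extended) metric space $X$, the Rips colimit $\varinjlim \mathrm{Rips}_* X$ exists in $\overline{\mathbf{Coarse}}$, and $X$ is canonically isomorphic to it: the canonical morphism $\varinjlim \mathrm{Rips}_* X \to X$ induced by the canonical cocone $\bar\xi$ under $\mathrm{Rips}_*X$ is an isomorphism in $\overline{\mathbf{Coarse}}$ (i.e. $\bar\xi$ is a colimit cocone).
   Context: Metric spaces are extended: distances may be $\infty$. Maps $f,f'\colon X\to Y$ between metric spaces are close if $\sup_{x} d_Y(fx,f'x)<\infty$; $\bar f$ denotes the closeness class of $f$. An upper control for $f\colon X\to Y$ is a proper (non-strictly) increasing function $\rho\colon[0,\infty)\to[0,\infty)$ with $d_Y(fx,fx')\le \rho(d_X(x,x'))$ for all $x,x'$ with $d_X(x,x')<\infty$ (no condition when $d_X(x,x')=\infty$). $f$ is controlled if it admits an upper control. The metric coarse category $\overline{\mathbf{Coarse}}$ has metric spaces as objects and closeness classes of controlled maps as morphisms. For $\sigma\ge 0$, $\mathrm{Rips}_\sigma X$ is the graph with vertex set $X$ in which distinct $x,x'$ are adjacent iff $d(x,x')\le\sigma$; it is regarded as the metric space $(X,d_\sigma)$ where $d_\sigma$ is the combinatorial path metric on vertices ($\infty$ if there is no path). The metric Rips filtration $\mathrm{Rips}_*X$ is the directed system indexed by $([0,\infty),\le)$ whose transition maps $\mathrm{Rips}_\sigma X\to\mathrm{Rips}_\tau X$ ($\sigma\le\tau$) are the underlying identities (1-Lipschitz). The Rips colimit of $X$ is the categorical colimit of this system (morphisms taken up to closeness). The canonical cocone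 $\bar\xi\colon \mathrm{Rips}_*X\Rightarrow X$ has legs $\bar\xi_\sigma\colon\mathrm{Rips}_\sigma X\to X$ given by the closeness class of the underlying identity map. *)

theory Defs
  imports "HOL-Analysis.Analysis"
begin

section \<open>Extended metric spaces\<close>

text \<open>
  As for the library type \<open>metric\<close>, a space is a carrier set (possibly empty) in an ambient type
  together with a distance; here distances lie in \<open>[0, \<infinity>]\<close>, and the values of the
  distance function outside the carrier are irrelevant.
\<close>

definition extended_metric :: "'a set \<Rightarrow> ('a \<Rightarrow> 'a \<Rightarrow> ennreal) \<Rightarrow> bool" where
  "extended_metric M d \<longleftrightarrow>
     (\<forall>x\<in>M. \<forall>y\<in>M. d x y = 0 \<longleftrightarrow> x = y) \<and>
     (\<forall>x\<in>M. \<forall>y\<in>M. d x y = d y x) \<and>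
     (\<forall>x\<in>M. \<forall>y\<in>M. \<forall>z\<in>M. d x z \<le> d x y + d y z)"

typedef 'a emetric = "{(M :: 'a set, d). extended_metric M d}"
  by (auto simp: extended_metric_def intro: exI[of _ "{}"])

definition espace :: "'a emetric \<Rightarrow> 'a set" where
  "espace X = fst (Rep_emetric X)"

definition edist :: "'a emetric \<Rightarrow> 'a \<Rightarrow> 'a \<Rightarrow> ennreal" where
  "edist X = snd (Rep_emetric X)"

lemma extended_metric_emetric: "extended_metric (espace X) (edist X)"
  using Rep_emetric[of X] by (auto simp: espace_def edist_def)

lemma
  assumes "extended_metric M d"
  shows espace_Abs: "espace (Abs_emetric (M, d)) = M"
    and edist_Abs: "edist (Abs_emetric (M, d)) = d"
  using assms by (simp_all add: espace_def edist_def Abs_emetric_inverse)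

lemma edist_zero: "x \<in> espace X \<Longrightarrow> y \<in> espace X \<Longrightarrow> edist X x y = 0 \<longleftrightarrow> x = y"
  using extended_metric_emetric[of X] by (auto simp: extended_metric_def)

lemma edist_commute: "x \<in> espace X \<Longrightarrow> y \<in> espace X \<Longrightarrow> edist X x y = edist X y x"
  using extended_metric_emetric[of X] by (auto simp: extended_metric_def)

lemma edist_triangle:
  "x \<in> espace X \<Longrightarrow> y \<in> espace X \<Longrightarrow> z \<in> espace X \<Longrightarrow> edist X x z \<le> edist X x y + edist X y z"
  using extended_metric_emetric[of X] by (auto simp: extended_metric_def)

section \<open>The metric coarse category\<close>

definition close :: "'a emetric \<Rightarrow> 'b emetric \<Rightarrow> ('a \<Rightarrow> 'b) \<Rightarrow> ('a \<Rightarrow> 'b) \<Rightarrow> bool" where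
  "close X Y f g \<longleftrightarrow> (SUP x\<in>espace X. edist Y (f x) (g x)) < \<infinity>"

text \<open>
  Properness of a not necessarily continuous function is meant metrically: preimages of bounded
  sets are bounded.
\<close>

definition proper_increasing :: "(real \<Rightarrow> real) \<Rightarrow> bool" where
  "proper_increasing \<rho> \<longleftrightarrow>
     \<rho> \<in> {0..} \<rightarrow> {0..} \<and> mono_on {0..} \<rho> \<and>
     (\<forall>B \<subseteq> {0..}. bounded B \<longrightarrow> bounded (\<rho> -` B \<inter> {0..}))"

definition upper_control ::
    "'a emetric \<Rightarrow> 'b emetric \<Rightarrow> (real \<Rightarrow> real) \<Rightarrow> ('a \<Rightarrow> 'b) \<Rightarrow> bool" where
  "upper_control X Y \<rho> f \<longleftrightarrow>
     proper_increasing \<rho> \<and>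
     (\<forall>x\<in>espace X. \<forall>x'\<in>espace X. edist X x x' < \<infinity> \<longrightarrow>
        edist Y (f x) (f x') \<le> ennreal (\<rho> (enn2real (edist X x x'))))"

definition controlled :: "'a emetric \<Rightarrow> 'b emetric \<Rightarrow> ('a \<Rightarrow> 'b) \<Rightarrow> bool" where
  "controlled X Y f \<longleftrightarrow> f \<in> espace X \<rightarrow> espace Y \<and> (\<exists>\<rho>. upper_control X Y \<rho> f)"

text \<open>
  Maps are HOL functions on the whole ambient type. Their values outside the carrier are immaterial:
  functions that agree on the carrier are close and hence define the same class.
\<close>

definition close_class :: "'a emetric \<Rightarrow> 'b emetric \<Rightarrow> ('a \<Rightarrow> 'b) \<Rightarrow> ('a \<Rightarrow> 'b) set" where
  "close_class X Y f = {g. g \<in> espace X \<rightarrow> espace Y \<and> close X Y f g}"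

definition coarse_hom :: "'a emetric \<Rightarrow> 'b emetric \<Rightarrow> ('a \<Rightarrow> 'b) set set" where
  "coarse_hom X Y = {close_class X Y f | f. controlled X Y f}"

definition coarse_id :: "'a emetric \<Rightarrow> ('a \<Rightarrow> 'a) set" where
  "coarse_id X = close_class X X id"

text \<open>
  The union ranges over all choices of representatives; for morphisms all members of the union
  coincide, see \<open>coarse_comp_close_class\<close> below.
\<close>

definition coarse_comp ::
    "'a emetric \<Rightarrow> 'c emetric \<Rightarrow> ('b \<Rightarrow> 'c) set \<Rightarrow> ('a \<Rightarrow> 'b) set \<Rightarrow> ('a \<Rightarrow> 'c) set" where
  "coarse_comp X Z G F = (\<Union>g\<in>G. \<Union>f\<in>F. close_class X Z (g \<circ> f))"

definition coarse_iso :: "'a emetric \<Rightarrow> 'b emetric \<Rightarrow> ('a \<Rightarrow> 'b) set \<Rightarrow> bool" where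
  "coarse_iso X Y F \<longleftrightarrow>
     F \<in> coarse_hom X Y \<and>
     (\<exists>G\<in>coarse_hom Y X. coarse_comp X X G F = coarse_id X \<and> coarse_comp Y Y F G = coarse_id Y)"

lemma close_iff_bound:
  "close X Y f g \<longleftrightarrow> (\<exists>C<\<infinity>. \<forall>x\<in>espace X. edist Y (f x) (g x) \<le> C)"
proof
  assume "close X Y f g"
  then show "\<exists>C<\<infinity>. \<forall>x\<in>espace X. edist Y (f x) (g x) \<le> C"
    unfolding close_def by (intro exI[of _ "SUP x\<in>espace X. edist Y (f x) (g x)"]) (auto intro: SUP_upper)
next
  assume "\<exists>C<\<infinity>. \<forall>x\<in>espace X. edist Y (f x) (g x) \<le> C"
  then obtain C where "C < \<infinity>" "\<forall>x\<in>espace X. edist Y (f x) (g x) \<le> C" by blast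
  then show "close X Y f g"
    unfolding close_def by (meson SUP_least order_le_less_trans)
qed

lemma close_refl: "f \<in> espace X \<rightarrow> espace Y \<Longrightarrow> close X Y f f"
  unfolding close_iff_bound by (rule exI[of _ 0]) (auto simp: edist_zero Pi_iff)

lemma close_sym:
  assumes "f \<in> espace X \<rightarrow> espace Y" "g \<in> espace X \<rightarrow> espace Y" "close X Y f g"
  shows "close X Y g f"
  using assms edist_commute[of _ Y] unfolding close_iff_bound by (metis PiE)

lemma close_trans:
  assumes "f \<in> espace X \<rightarrow> espace Y" "g \<in> espace X \<rightarrow> espace Y" "h \<in> espace X \<rightarrow> espace Y"
    and "close X Y f g" "close X Y g h"
  shows "close X Y f h"
proof -
  from assms(4) obtain C where C: "C < \<infinity>" "\<forall>x\<in>espace X. edist Y (f x) (g x) \<le> C"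
    unfolding close_iff_bound by blast
  from assms(5) obtain D where D: "D < \<infinity>" "\<forall>x\<in>espace X. edist Y (g x) (h x) \<le> D"
    unfolding close_iff_bound by blast
  have "edist Y (f x) (h x) \<le> C + D" if "x \<in> espace X" for x
  proof -
    have "edist Y (f x) (h x) \<le> edist Y (f x) (g x) + edist Y (g x) (h x)"
      using that assms(1-3) by (intro edist_triangle) auto
    also have "\<dots> \<le> C + D" using that C D by (intro add_mono) auto
    finally show ?thesis .
  qed
  moreover have "C + D < \<infinity>" using C D by simp
  ultimately show ?thesis unfolding close_iff_bound by blast
qed

lemma close_class_eq:
  assumes "f \<in> espace X \<rightarrow> espace Y" "g \<in> espace X \<rightarrow> espace Y" "close X Y f g"
  shows "close_class X Y f = close_class X Y g"
proof -
  have "close X Y f h \<longleftrightarrow> close X Y g h" if "h \<in> espace X \<rightarrow> espace Y" for h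
    using assms that close_sym[OF assms] close_trans[of f X Y g h] close_trans[of g X Y f h] by metis
  then show ?thesis unfolding close_class_def by blast
qed

lemma close_comp:
  assumes f: "f \<in> espace X \<rightarrow> espace Y" "f' \<in> espace X \<rightarrow> espace Y" "close X Y f f'"
    and g: "controlled Y Z g" "g' \<in> espace Y \<rightarrow> espace Z" "close Y Z g g'"
  shows "close X Z (g \<circ> f) (g' \<circ> f')"
proof -
  from g(1) have gZ: "g \<in> espace Y \<rightarrow> espace Z" by (simp add: controlled_def)
  from g(1) obtain \<rho> where \<rho>: "upper_control Y Z \<rho> g" by (auto simp: controlled_def)
  have mono: "mono_on {0..} \<rho>"
    using \<rho> by (auto simp: upper_control_def proper_increasing_def)
  from f(3) obtain C where C: "C < \<infinity>" "\<forall>x\<in>espace X. edist Y (f x) (f' x) \<le> C"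
    unfolding close_iff_bound by blast
  have "edist Z (g (f x)) (g (f' x)) \<le> ennreal (\<rho> (enn2real C))" if x: "x \<in> espace X" for x
  proof -
    have le: "edist Y (f x) (f' x) \<le> C" using C x by blast
    then have "edist Y (f x) (f' x) < \<infinity>" using C by (rule_tac order_le_less_trans)
    then have "edist Z (g (f x)) (g (f' x)) \<le> ennreal (\<rho> (enn2real (edist Y (f x) (f' x))))"
      using \<rho> x f unfolding upper_control_def by blast
    also have "\<dots> \<le> ennreal (\<rho> (enn2real C))"
      using le C by (intro ennreal_leI mono_onD[OF mono] enn2real_mono) auto
    finally show ?thesis .
  qed
  then have "close X Z (g \<circ> f) (g \<circ> f')"
    unfolding close_iff_bound by (intro exI[of _ "ennreal (\<rho> (enn2real C))"]) auto
  moreover have "close X Z (g \<circ> f') (g' \<circ> f')"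
  proof -
    from g(3) obtain D where "D < \<infinity>" "\<forall>y\<in>espace Y. edist Z (g y) (g' y) \<le> D"
      unfolding close_iff_bound by blast
    then show ?thesis using f(2) unfolding close_iff_bound by (intro exI[of _ D]) auto
  qed
  ultimately show ?thesis
    using f g gZ by (intro close_trans[of "g \<circ> f" X Z "g \<circ> f'" "g' \<circ> f'"]) auto
qed

lemma coarse_comp_close_class:
  assumes f: "controlled X Y f" and g: "controlled Y Z g"
  shows "coarse_comp X Z (close_class Y Z g) (close_class X Y f) = close_class X Z (g \<circ> f)"
proof -
  from f g have fY: "f \<in> espace X \<rightarrow> espace Y" and gZ: "g \<in> espace Y \<rightarrow> espace Z"
    by (auto simp: controlled_def)
  have eq: "close_class X Z (g' \<circ> f') = close_class X Z (g \<circ> f)"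
    if "g' \<in> close_class Y Z g" "f' \<in> close_class X Y f" for f' g'
    using that fY gZ g close_comp[of f X Y f' Z g g']
    by (intro close_class_eq[symmetric]) (auto simp: close_class_def)
  have "f \<in> close_class X Y f" "g \<in> close_class Y Z g"
    using fY gZ by (auto simp: close_class_def close_refl)
  then show ?thesis unfolding coarse_comp_def using eq by blast
qed

section \<open>Colimits of systems indexed by the nonnegative reals\<close>

text \<open>
  A system is given by its objects \<open>D \<sigma>\<close> and transition morphisms \<open>t \<sigma> \<tau>\<close> from \<open>D \<sigma>\<close> to \<open>D \<tau>\<close>
  for \<open>0 \<le> \<sigma> \<le> \<tau>\<close>; values at other indices are irrelevant.
\<close>

definition cocone ::
    "(real \<Rightarrow> 'a emetric) \<Rightarrow> (real \<Rightarrow> real \<Rightarrow> ('a \<Rightarrow> 'a) set) \<Rightarrow>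
     'b emetric \<Rightarrow> (real \<Rightarrow> ('a \<Rightarrow> 'b) set) \<Rightarrow> bool" where
  "cocone D t L l \<longleftrightarrow>
     (\<forall>\<sigma>\<ge>0. l \<sigma> \<in> coarse_hom (D \<sigma>) L) \<and>
     (\<forall>\<sigma>\<ge>0. \<forall>\<tau>\<ge>\<sigma>. coarse_comp (D \<sigma>) L (l \<tau>) (t \<sigma> \<tau>) = l \<sigma>)"

definition cocone_morphism ::
    "(real \<Rightarrow> 'a emetric) \<Rightarrow> 'b emetric \<Rightarrow> (real \<Rightarrow> ('a \<Rightarrow> 'b) set) \<Rightarrow>
     'c emetric \<Rightarrow> (real \<Rightarrow> ('a \<Rightarrow> 'c) set) \<Rightarrow> ('b \<Rightarrow> 'c) set \<Rightarrow> bool" where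
  "cocone_morphism D L l Y m H \<longleftrightarrow>
     H \<in> coarse_hom L Y \<and> (\<forall>\<sigma>\<ge>0. coarse_comp (D \<sigma>) Y H (l \<sigma>) = m \<sigma>)"

text \<open>
  HOL cannot quantify over types inside a formula, so the universal property is relative to test
  objects whose points lie in the type \<open>'c\<close>; a colimit satisfies it for every \<open>'c\<close>.
\<close>

definition colimit_cocone ::
    "'c itself \<Rightarrow> (real \<Rightarrow> 'a emetric) \<Rightarrow> (real \<Rightarrow> real \<Rightarrow> ('a \<Rightarrow> 'a) set) \<Rightarrow>
     'b emetric \<Rightarrow> (real \<Rightarrow> ('a \<Rightarrow> 'b) set) \<Rightarrow> bool" where
  "colimit_cocone (_ :: 'c itself) D t L l \<longleftrightarrow>
     cocone D t L l \<and>
     (\<forall>(Y :: 'c emetric) m. cocone D t Y m \<longrightarrow> (\<exists>!H. cocone_morphism D L l Y m H))"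

section \<open>The metric Rips filtration\<close>

definition rips_edges :: "real \<Rightarrow> 'a emetric \<Rightarrow> 'a rel" where
  "rips_edges \<sigma> X =
     {(x, y). x \<in> espace X \<and> y \<in> espace X \<and> x \<noteq> y \<and> edist X x y \<le> ennreal \<sigma>}"

text \<open>\<open>E ^^ n\<close> relates the end points of walks of length \<open>n\<close>; the infimum of the empty set is \<open>\<infinity>\<close>.\<close>

definition path_dist :: "'a rel \<Rightarrow> 'a \<Rightarrow> 'a \<Rightarrow> ennreal" where
  "path_dist E x y = (INF n\<in>{n. (x, y) \<in> E ^^ n}. of_nat n)"

definition Rips :: "real \<Rightarrow> 'a emetric \<Rightarrow> 'a emetric" where
  "Rips \<sigma> X = Abs_emetric (espace X, path_dist (rips_edges \<sigma> X))"

lemma path_dist_le: "(x, y) \<in> E ^^ n \<Longrightarrow> path_dist E x y \<le> of_nat n"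
  unfolding path_dist_def by (intro INF_lower) auto

lemma path_dist_cases:
  obtains "path_dist E x y = \<infinity>" | n where "(x, y) \<in> E ^^ n" "path_dist E x y = of_nat n"
proof (cases "\<exists>n. (x, y) \<in> E ^^ n")
  case False
  then have "path_dist E x y = \<infinity>" by (simp add: path_dist_def)
  then show ?thesis by (rule that(1))
next
  case True
  define n where "n = (LEAST n. (x, y) \<in> E ^^ n)"
  have n: "(x, y) \<in> E ^^ n" using True unfolding n_def by (rule LeastI_ex)
  have "of_nat n \<le> path_dist E x y"
    unfolding path_dist_def n_def by (intro INF_greatest) (auto intro: Least_le)
  with path_dist_le[OF n] have "path_dist E x y = of_nat n" by (rule antisym)
  with n show ?thesis by (rule that(2))
qed

lemma extended_metric_path_dist:
  assumes "sym E"
  shows "extended_metric M (path_dist E)"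
proof -
  have zero: "path_dist E x y = 0 \<longleftrightarrow> x = y" for x y
  proof
    assume "path_dist E x y = 0"
    then show "x = y" by (cases rule: path_dist_cases[where E=E and x=x and y=y]) auto
  next
    assume "x = y"
    then show "path_dist E x y = 0" using path_dist_le[where E=E and x=x and y=y and n=0] by simp
  qed
  have rev: "(y, x) \<in> E ^^ n" if "(x, y) \<in> E ^^ n" for x y n
    using that
  proof (induction n arbitrary: y)
    case (Suc n)
    from Suc.prems obtain z where "(x, z) \<in> E ^^ n" "(z, y) \<in> E" by (rule relpow_Suc_E)
    then show ?case using Suc.IH assms by (meson relpow_Suc_I2 symD)
  qed auto
  have commute: "path_dist E x y = path_dist E y x" for x y
  proof -
    have "{n. (x, y) \<in> E ^^ n} = {n. (y, x) \<in> E ^^ n}" using rev by blast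
    then show ?thesis by (simp add: path_dist_def)
  qed
  have triangle: "path_dist E x z \<le> path_dist E x y + path_dist E y z" for x y z
  proof (cases rule: path_dist_cases[where E=E and x=x and y=y])
    case (2 m)
    note m = 2
    show ?thesis
    proof (cases rule: path_dist_cases[where E=E and x=y and y=z])
      case (2 n)
      with m have "(x, z) \<in> E ^^ (m + n)" by (auto simp: relpow_add)
      from path_dist_le[OF this] show ?thesis using m 2 by simp
    qed simp
  qed simp
  show ?thesis
    unfolding extended_metric_def by (intro conjI ballI zero commute triangle)
qed

lemma sym_rips_edges: "sym (rips_edges \<sigma> X)"
  by (auto simp: sym_def rips_edges_def edist_commute)

lemma espace_Rips: "espace (Rips \<sigma> X) = espace X"
  and edist_Rips: "edist (Rips \<sigma> X) = path_dist (rips_edges \<sigma> X)"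
  unfolding Rips_def
  by (simp_all add: espace_Abs edist_Abs extended_metric_path_dist sym_rips_edges)

definition rips_transition :: "'a emetric \<Rightarrow> real \<Rightarrow> real \<Rightarrow> ('a \<Rightarrow> 'a) set" where
  "rips_transition X \<sigma> \<tau> = close_class (Rips \<sigma> X) (Rips \<tau> X) id"

definition rips_cocone :: "'a emetric \<Rightarrow> real \<Rightarrow> ('a \<Rightarrow> 'a) set" where
  "rips_cocone X \<sigma> = close_class (Rips \<sigma> X) X id"

end

theory Submission
  imports Defs
begin

text \<open>
  A map is controlled as soon as it sends pairs at distance at most \<open>r\<close> to pairs at bounded
  distance, for every \<open>r\<close>; pairs of points of \<open>X\<close> at distance at most \<open>r\<close> are at distance at most
  \<open>1\<close> in \<open>Rips r X\<close>. Closeness of maps out of \<open>Rips \<sigma> X\<close> does not depend on \<open>\<sigma>\<close>, so the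
  legs \<open>g\<^sub>\<sigma>\<close> of a cocone to \<open>Y\<close> are all close to the single map \<open>g\<^sub>0\<close>. This map is controlled on \<open>X\<close>
  itself, because at scale \<open>r\<close> it can be compared with \<open>g\<^sub>r\<close>, and it represents the unique
  morphism from \<open>X\<close>.
\<close>

section \<open>Controlled maps through bounds at each scale\<close>

lemma controlled_iff:
  "controlled X Y f \<longleftrightarrow> f \<in> espace X \<rightarrow> espace Y \<and>
     (\<forall>r\<ge>0. \<exists>C<\<infinity>. \<forall>x\<in>espace X. \<forall>x'\<in>espace X.
        edist X x x' \<le> ennreal r \<longrightarrow> edist Y (f x) (f x') \<le> C)"
    (is "_ \<longleftrightarrow> _ \<and> ?bounded")
proof
  assume f: "controlled X Y f"
  then obtain \<rho> where \<rho>: "upper_control X Y \<rho> f" by (auto simp: controlled_def)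
  have mono: "mono_on {0..} \<rho>"
    using \<rho> by (auto simp: upper_control_def proper_increasing_def)
  have "edist Y (f x) (f x') \<le> ennreal (\<rho> r)"
    if "r \<ge> 0" and x: "x \<in> espace X" "x' \<in> espace X" "edist X x x' \<le> ennreal r" for r x x'
  proof -
    have "edist X x x' < \<infinity>" using x(3) by (rule order_le_less_trans) simp
    then have "edist Y (f x) (f x') \<le> ennreal (\<rho> (enn2real (edist X x x')))"
      using \<rho> x unfolding upper_control_def by blast
    also have "\<dots> \<le> ennreal (\<rho> r)"
      using that by (intro ennreal_leI mono_onD[OF mono]) (auto intro: enn2real_leI)
    finally show ?thesis .
  qed
  then have ?bounded by (metis ennreal_less_top infinity_ennreal_def)
  with f show "f \<in> espace X \<rightarrow> espace Y \<and> ?bounded" by (simp add: controlled_def)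
next
  assume f: "f \<in> espace X \<rightarrow> espace Y \<and> ?bounded"
  define P where
    "P r = {(x, x'). x \<in> espace X \<and> x' \<in> espace X \<and> edist X x x' \<le> ennreal r}" for r
  \<comment> \<open>Bounds chosen separately for each \<open>r\<close> need not increase with
    \<open>r\<close>. The least bound does, because \<open>P r\<close> grows with
    \<open>r\<close>.\<close>
  define S where "S r = (SUP (x, x')\<in>P r. edist Y (f x) (f x'))" for r
  \<comment> \<open>\<open>S\<close> can be a bounded function, for instance if \<open>f\<close> is
    constant. The summand \<open>r\<close> gives \<open>\<rho> t \<ge> t\<close>, which makes
    \<open>\<rho>\<close> proper.\<close>
  define \<rho> where "\<rho> r = r + enn2real (S r)" for r
  have S_finite: "S r < \<infinity>" if r: "r \<ge> 0" for r
  proof -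
    obtain C where "C < \<infinity>" "\<forall>x\<in>espace X. \<forall>x'\<in>espace X.
        edist X x x' \<le> ennreal r \<longrightarrow> edist Y (f x) (f x') \<le> C"
      using f r by blast
    then have "S r \<le> C" unfolding S_def P_def by (intro SUP_least) auto
    then show ?thesis using \<open>C < \<infinity>\<close> by (rule order_le_less_trans)
  qed
  have S_mono: "S r \<le> S s" if "r \<le> s" for r s
    unfolding S_def P_def
    by (rule SUP_subset_mono) (use that in \<open>auto intro: order_trans ennreal_leI\<close>)
  have "mono_on {0..} \<rho>"
    unfolding \<rho>_def
    by (intro mono_onI add_mono enn2real_mono S_mono) (use S_finite in auto)
  moreover have "bounded (\<rho> -` B \<inter> {0..})" if B: "bounded B" for B
  proof -
    obtain b where b: "\<And>y. y \<in> B \<Longrightarrow> \<bar>y\<bar> \<le> b" using B by (auto simp: bounded_real)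
    have "t \<le> b" if "\<rho> t \<in> B" for t
      using b[OF that] enn2real_nonneg[of "S t"] unfolding \<rho>_def by linarith
    then have "\<rho> -` B \<inter> {0..} \<subseteq> {0..b}" by auto
    then show ?thesis by (rule bounded_subset[OF bounded_closed_interval])
  qed
  ultimately have "proper_increasing \<rho>"
    unfolding proper_increasing_def by (auto simp: \<rho>_def)
  moreover have "edist Y (f x) (f x') \<le> ennreal (\<rho> (enn2real (edist X x x')))"
    if "x \<in> espace X" "x' \<in> espace X" "edist X x x' < \<infinity>" for x x'
  proof -
    define r where "r = enn2real (edist X x x')"
    have r: "0 \<le> r" "edist X x x' = ennreal r" using that(3) by (auto simp: r_def)
    have "edist Y (f x) (f x') \<le> S r"
      unfolding S_def by (rule SUP_upper2[of "(x, x')"]) (use that r in \<open>auto simp: P_def\<close>)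
    also have "\<dots> = ennreal (enn2real (S r))" using S_finite[OF r(1)] by simp
    also have "\<dots> \<le> ennreal (\<rho> r)" using r(1) by (intro ennreal_leI) (simp add: \<rho>_def)
    finally show ?thesis by (simp add: r_def)
  qed
  ultimately have "upper_control X Y \<rho> f" unfolding upper_control_def by blast
  with f show "controlled X Y f" unfolding controlled_def by blast
qed

lemma controlledI:
  assumes "f \<in> espace X \<rightarrow> espace Y"
    and "\<And>r. r \<ge> 0 \<Longrightarrow> \<exists>C<\<infinity>. \<forall>x\<in>espace X. \<forall>x'\<in>espace X.
           edist X x x' \<le> ennreal r \<longrightarrow> edist Y (f x) (f x') \<le> C"
  shows "controlled X Y f"
  using assms by (simp add: controlled_iff)

lemma controlledE:
  assumes "controlled X Y f" "r \<ge> 0"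
  obtains C where "C < \<infinity>"
    and "\<And>x x'. x \<in> espace X \<Longrightarrow> x' \<in> espace X \<Longrightarrow> edist X x x' \<le> ennreal r \<Longrightarrow>
           edist Y (f x) (f x') \<le> C"
  using assms unfolding controlled_iff by blast

lemma controlled_maps: "controlled X Y f \<Longrightarrow> f \<in> espace X \<rightarrow> espace Y"
  by (simp add: controlled_def)

lemma controlled_id: "controlled X X id"
  by (rule controlledI) (auto intro: exI[of _ "ennreal _"])

text \<open>The bound \<open>C\<close> of \<open>f\<close> at scale \<open>r\<close> is finite, so
  it can serve as the scale at which \<open>g\<close> is bounded.\<close>

lemma controlled_comp:
  assumes f: "controlled X Y f" and g: "controlled Y Z g"
  shows "controlled X Z (g \<circ> f)"
proof (rule controlledI)
  show "g \<circ> f \<in> espace X \<rightarrow> espace Z"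
    using controlled_maps[OF f] controlled_maps[OF g] by auto
next
  fix r :: real assume "r \<ge> 0"
  with f obtain C where C: "C < \<infinity>"
    "\<And>x x'. x \<in> espace X \<Longrightarrow> x' \<in> espace X \<Longrightarrow> edist X x x' \<le> ennreal r \<Longrightarrow> edist Y (f x) (f x') \<le> C"
    by (rule controlledE) blast
  obtain D where D: "D < \<infinity>" "\<And>y y'. y \<in> espace Y \<Longrightarrow> y' \<in> espace Y \<Longrightarrow>
      edist Y y y' \<le> ennreal (enn2real C) \<Longrightarrow> edist Z (g y) (g y') \<le> D"
    using g enn2real_nonneg by (rule controlledE) blast
  have "ennreal (enn2real C) = C" using C(1) by simp
  then show "\<exists>D<\<infinity>. \<forall>x\<in>espace X. \<forall>x'\<in>espace X.
      edist X x x' \<le> ennreal r \<longrightarrow> edist Z ((g \<circ> f) x) ((g \<circ> f) x') \<le> D"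
    using C D controlled_maps[OF f] by (intro exI[of _ D]) (auto simp: Pi_iff)
qed

section \<open>Morphisms as closeness classes, and the category laws\<close>

lemma close_class_in_coarse_hom: "controlled X Y f \<Longrightarrow> close_class X Y f \<in> coarse_hom X Y"
  by (auto simp: coarse_hom_def)

lemma coarse_homE:
  assumes "F \<in> coarse_hom X Y"
  obtains f where "controlled X Y f" "F = close_class X Y f"
  using assms by (auto simp: coarse_hom_def)

text \<open>Turns equations between morphisms into closeness of representatives. The direction
  missing from \<open>close_class_eq\<close> holds because \<open>g\<close> lies in its own
  class.\<close>

lemma close_class_eq_iff:
  assumes "f \<in> espace X \<rightarrow> espace Y" "g \<in> espace X \<rightarrow> espace Y"
  shows "close_class X Y f = close_class X Y g \<longleftrightarrow> close X Y f g"
proof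
  assume "close_class X Y f = close_class X Y g"
  moreover have "g \<in> close_class X Y g" using assms close_refl by (simp add: close_class_def)
  ultimately show "close X Y f g" by (auto simp: close_class_def)
qed (rule close_class_eq[OF assms])

lemma coarse_id_in_coarse_hom: "coarse_id X \<in> coarse_hom X X"
  unfolding coarse_id_def by (intro close_class_in_coarse_hom controlled_id)

lemma coarse_comp_in_coarse_hom:
  assumes "F \<in> coarse_hom X Y" "G \<in> coarse_hom Y Z"
  shows "coarse_comp X Z G F \<in> coarse_hom X Z"
  using assms
  by (auto elim!: coarse_homE simp: coarse_comp_close_class
      intro!: close_class_in_coarse_hom controlled_comp)

lemma coarse_comp_id_left: "F \<in> coarse_hom X Y \<Longrightarrow> coarse_comp X Y (coarse_id Y) F = F"
  unfolding coarse_id_def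
  by (auto elim!: coarse_homE simp: coarse_comp_close_class controlled_id)

lemma coarse_comp_assoc:
  assumes "F \<in> coarse_hom W X" "G \<in> coarse_hom X Y" "H \<in> coarse_hom Y Z"
  shows "coarse_comp W Z (coarse_comp X Z H G) F = coarse_comp W Z H (coarse_comp W Y G F)"
  using assms
  by (auto elim!: coarse_homE simp: coarse_comp_close_class controlled_comp comp_assoc)

section \<open>Distances in the Rips graphs\<close>

text \<open>Closeness sees only the carrier of the domain, not its metric, and all Rips graphs share
  the carrier of \<open>X\<close>.\<close>

lemma close_Rips [simp]: "close (Rips \<sigma> X) Y f g \<longleftrightarrow> close X Y f g"
  by (simp add: close_def espace_Rips)

text \<open>Triangle inequality along a walk. Membership of \<open>y\<close> is carried through the
  induction because \<open>edist_triangle\<close> requires all points to lie in the carrier.\<close>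

lemma edist_le_relpow_rips_edges:
  assumes "(x, y) \<in> rips_edges \<sigma> X ^^ n" "x \<in> espace X"
  shows "y \<in> espace X \<and> edist X x y \<le> of_nat n * ennreal \<sigma>"
  using assms
proof (induction n arbitrary: y)
  case 0
  then show ?case by (simp add: edist_zero)
next
  case (Suc n)
  from Suc.prems(1) obtain z where "(x, z) \<in> rips_edges \<sigma> X ^^ n" and zy: "(z, y) \<in> rips_edges \<sigma> X"
    by (rule relpow_Suc_E)
  with Suc have z: "z \<in> espace X" "edist X x z \<le> of_nat n * ennreal \<sigma>" by auto
  have y: "y \<in> espace X" "edist X z y \<le> ennreal \<sigma>" using zy by (auto simp: rips_edges_def)
  have "edist X x y \<le> edist X x z + edist X z y"
    using Suc.prems(2) z y by (intro edist_triangle)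
  also have "\<dots> \<le> of_nat n * ennreal \<sigma> + ennreal \<sigma>" using z y by (intro add_mono)
  finally show ?case using y by (simp add: distrib_right add.commute)
qed

text \<open>The walk bound is applied to a shortest walk. Finiteness matters when
  \<open>ennreal \<sigma> = 0\<close>: distinct points are then at infinite Rips distance, but
  \<open>\<infinity> * 0 = 0\<close>.\<close>

lemma edist_le_edist_Rips:
  assumes "x \<in> espace X" "edist (Rips \<sigma> X) x y < \<infinity>"
  shows "edist X x y \<le> edist (Rips \<sigma> X) x y * ennreal \<sigma>"
  using assms edist_le_relpow_rips_edges[of x y _ \<sigma> X]
  by (cases rule: path_dist_cases[of "rips_edges \<sigma> X" x y]) (auto simp: edist_Rips)

lemma edist_Rips_le_1:
  assumes "x \<in> espace X" "y \<in> espace X" "edist X x y \<le> ennreal \<sigma>"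
  shows "edist (Rips \<sigma> X) x y \<le> 1"
\<comment> \<open>The graph has no loops, so equal points are joined by the walk of length 0 instead
  of an edge.\<close>
proof (cases "x = y")
  case True
  then show ?thesis using path_dist_le[of x y 0 "rips_edges \<sigma> X"] by (simp add: edist_Rips)
next
  case False
  with assms have "(x, y) \<in> rips_edges \<sigma> X ^^ 1" by (simp add: rips_edges_def)
  from path_dist_le[OF this] show ?thesis by (simp add: edist_Rips)
qed

text \<open>On each connected component, where Rips distances are finite, the identity is Lipschitz
  with constant \<open>ennreal \<sigma>\<close>.\<close>

lemma controlled_Rips_id: "controlled (Rips \<sigma> X) X id"
proof (rule controlledI)
  fix r :: real assume r: "r \<ge> 0"
  have "edist X x x' \<le> ennreal r * ennreal \<sigma>"
    if "x \<in> espace X" and le: "edist (Rips \<sigma> X) x x' \<le> ennreal r" for x x'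
  proof -
    have "edist (Rips \<sigma> X) x x' < \<infinity>" using le by (rule order_le_less_trans) simp
    then have "edist X x x' \<le> edist (Rips \<sigma> X) x x' * ennreal \<sigma>"
      using that by (intro edist_le_edist_Rips)
    also have "\<dots> \<le> ennreal r * ennreal \<sigma>" using le by (rule mult_right_mono) simp
    finally show ?thesis .
  qed
  then show "\<exists>C<\<infinity>. \<forall>x\<in>espace (Rips \<sigma> X). \<forall>x'\<in>espace (Rips \<sigma> X).
      edist (Rips \<sigma> X) x x' \<le> ennreal r \<longrightarrow> edist X (id x) (id x') \<le> C"
    by (intro exI[of _ "ennreal r * ennreal \<sigma>"]) (simp add: espace_Rips ennreal_mult_less_top)
qed (simp add: espace_Rips)

text \<open>A larger scale has more edges and hence more walks, so the infimum runs over a larger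
  set of lengths.\<close>

lemma edist_Rips_antimono:
  assumes "\<sigma> \<le> \<tau>"
  shows "edist (Rips \<tau> X) x y \<le> edist (Rips \<sigma> X) x y"
proof -
  have "rips_edges \<sigma> X \<subseteq> rips_edges \<tau> X"
    using assms by (auto simp: rips_edges_def intro: order_trans ennreal_leI)
  then have "{n. (x, y) \<in> rips_edges \<sigma> X ^^ n} \<subseteq> {n. (x, y) \<in> rips_edges \<tau> X ^^ n}"
    using relpowp_mono[to_set, of "rips_edges \<sigma> X" "rips_edges \<tau> X"] by blast
  then show ?thesis unfolding edist_Rips path_dist_def by (rule INF_superset_mono) simp
qed

lemma controlled_rips_transition:
  assumes "\<sigma> \<le> \<tau>"
  shows "controlled (Rips \<sigma> X) (Rips \<tau> X) id"
proof (rule controlledI)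
  fix r :: real
  show "\<exists>C<\<infinity>. \<forall>x\<in>espace (Rips \<sigma> X). \<forall>x'\<in>espace (Rips \<sigma> X).
      edist (Rips \<sigma> X) x x' \<le> ennreal r \<longrightarrow> edist (Rips \<tau> X) (id x) (id x') \<le> C"
    by (intro exI[of _ "ennreal r"])
      (auto intro: order_trans[OF edist_Rips_antimono[OF assms]])
qed (simp add: espace_Rips)

section \<open>The Rips cocone and its universal property\<close>

text \<open>The leg is the class of \<open>id\<close>, so composing with it keeps the representative
  \<open>h\<close> and changes only the domain.\<close>

lemma coarse_comp_rips_cocone:
  "controlled X Y h \<Longrightarrow>
    coarse_comp (Rips \<sigma> X) Y (close_class X Y h) (rips_cocone X \<sigma>) = close_class (Rips \<sigma> X) Y h"
  by (simp add: rips_cocone_def coarse_comp_close_class controlled_Rips_id)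

lemma coarse_comp_rips_transition:
  "\<sigma> \<le> \<tau> \<Longrightarrow> controlled (Rips \<tau> X) Y h \<Longrightarrow>
    coarse_comp (Rips \<sigma> X) Y (close_class (Rips \<tau> X) Y h) (rips_transition X \<sigma> \<tau>) =
    close_class (Rips \<sigma> X) Y h"
  by (simp add: rips_transition_def coarse_comp_close_class controlled_rips_transition)

lemma cocone_rips_cocone: "cocone (\<lambda>\<sigma>. Rips \<sigma> X) (rips_transition X) X (rips_cocone X)"
  unfolding cocone_def rips_cocone_def
  by (simp add: coarse_comp_rips_transition close_class_in_coarse_hom controlled_Rips_id)

text \<open>The path from \<open>f x\<close> to \<open>f x'\<close> makes a detour through
  \<open>g r x\<close> and \<open>g r x'\<close>, whose distance is bounded since \<open>x\<close>
  and \<open>x'\<close> are equal or adjacent in \<open>Rips r X\<close>. The bound at scale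
  \<open>r\<close> may depend on \<open>r\<close>, so only the closeness constant of
  \<open>g r\<close> enters.\<close>

lemma controlled_if_close_to_Rips:
  assumes g: "\<And>\<sigma>. \<sigma> \<ge> 0 \<Longrightarrow> controlled (Rips \<sigma> X) Y (g \<sigma>)"
    and f: "f \<in> espace X \<rightarrow> espace Y" "\<And>\<sigma>. \<sigma> \<ge> 0 \<Longrightarrow> close X Y f (g \<sigma>)"
  shows "controlled X Y f"
proof (rule controlledI)
  fix r :: real assume r: "r \<ge> 0"
  have gY: "g r \<in> espace X \<rightarrow> espace Y"
    using controlled_maps[OF g[OF r]] by (simp add: espace_Rips)
  obtain C where C: "C < \<infinity>" "\<And>x. x \<in> espace X \<Longrightarrow> edist Y (f x) (g r x) \<le> C"
    using f(2)[OF r] unfolding close_iff_bound by blast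
  obtain D where D: "D < \<infinity>" "\<And>x x'. x \<in> espace X \<Longrightarrow> x' \<in> espace X \<Longrightarrow>
      edist (Rips r X) x x' \<le> ennreal 1 \<Longrightarrow> edist Y (g r x) (g r x') \<le> D"
    using g[OF r] by (rule controlledE[of _ _ _ 1]) (auto simp: espace_Rips)
  have "edist Y (f x) (f x') \<le> C + (D + C)"
    if x: "x \<in> espace X" "x' \<in> espace X" "edist X x x' \<le> ennreal r" for x x'
  proof -
    have Y: "f x \<in> espace Y" "f x' \<in> espace Y" "g r x \<in> espace Y" "g r x' \<in> espace Y"
      using f(1) gY x by auto
    have "edist Y (f x) (f x') \<le> edist Y (f x) (g r x) + edist Y (g r x) (f x')"
      using Y by (intro edist_triangle)
    also have "edist Y (g r x) (f x') \<le> edist Y (g r x) (g r x') + edist Y (g r x') (f x')"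
      using Y by (intro edist_triangle)
    also have "edist Y (g r x') (f x') = edist Y (f x') (g r x')"
      using Y by (intro edist_commute)
    also have "edist Y (f x) (g r x) + (edist Y (g r x) (g r x') + edist Y (f x') (g r x')) \<le> C + (D + C)"
      using x edist_Rips_le_1[OF x] by (intro add_mono C D) auto
    finally show ?thesis by (simp add: add_left_mono)
  qed
  moreover have "C + (D + C) < \<infinity>" using C(1) D(1) by simp
  ultimately show "\<exists>C<\<infinity>. \<forall>x\<in>espace X. \<forall>x'\<in>espace X.
      edist X x x' \<le> ennreal r \<longrightarrow> edist Y (f x) (f x') \<le> C"
    by blast
qed (rule f(1))

lemma colimit_cocone_rips_cocone:
  "colimit_cocone TYPE('b) (\<lambda>\<sigma>. Rips \<sigma> X) (rips_transition X) X (rips_cocone X)"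
  unfolding colimit_cocone_def
proof (intro conjI cocone_rips_cocone allI impI)
  fix Y :: "'b emetric" and m
  assume m: "cocone (\<lambda>\<sigma>. Rips \<sigma> X) (rips_transition X) Y m"
  have "\<exists>h. controlled (Rips \<sigma> X) Y h \<and> m \<sigma> = close_class (Rips \<sigma> X) Y h" if "\<sigma> \<ge> 0" for \<sigma>
    using m that unfolding cocone_def by (meson coarse_homE)
  then obtain g where g: "\<And>\<sigma>. \<sigma> \<ge> 0 \<Longrightarrow> controlled (Rips \<sigma> X) Y (g \<sigma>)"
    and mg: "\<And>\<sigma>. \<sigma> \<ge> 0 \<Longrightarrow> m \<sigma> = close_class (Rips \<sigma> X) Y (g \<sigma>)"
    by metis
  have gY: "g \<sigma> \<in> espace X \<rightarrow> espace Y" if "\<sigma> \<ge> 0" for \<sigma>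
    using controlled_maps[OF g[OF that]] by (simp add: espace_Rips)
  have close_class_iff: "close_class (Rips \<sigma> X) Y h = close_class (Rips \<sigma> X) Y h' \<longleftrightarrow> close X Y h h'"
    if "h \<in> espace X \<rightarrow> espace Y" "h' \<in> espace X \<rightarrow> espace Y" for \<sigma> h h'
    using that by (simp add: close_class_eq_iff espace_Rips)
  have close_g: "close X Y (g 0) (g \<sigma>)" if \<sigma>: "\<sigma> \<ge> 0" for \<sigma>
  proof -
    \<comment> \<open>The transition from scale 0 is the class of \<open>id\<close>, so this cocone
      equation compares \<open>g \<sigma>\<close> and \<open>g 0\<close> as maps on the same
      points.\<close>
    have "coarse_comp (Rips 0 X) Y (m \<sigma>) (rips_transition X 0 \<sigma>) = m 0"
      using m \<sigma> unfolding cocone_def by blast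
    then have "close X Y (g \<sigma>) (g 0)"
      using \<sigma> by (simp add: mg g coarse_comp_rips_transition close_class_iff gY)
    then show ?thesis using \<sigma> by (rule close_sym[OF gY gY, rotated 2]) simp
  qed
  have ctrl: "controlled X Y (g 0)"
    by (rule controlled_if_close_to_Rips[OF g gY close_g]) auto
  show "\<exists>!H. cocone_morphism (\<lambda>\<sigma>. Rips \<sigma> X) X (rips_cocone X) Y m H"
  proof (rule ex1I[of _ "close_class X Y (g 0)"])
    show "cocone_morphism (\<lambda>\<sigma>. Rips \<sigma> X) X (rips_cocone X) Y m (close_class X Y (g 0))"
      unfolding cocone_morphism_def
      by (auto simp: close_class_in_coarse_hom ctrl coarse_comp_rips_cocone mg close_class_iff gY close_g)
  next
    fix H assume H: "cocone_morphism (\<lambda>\<sigma>. Rips \<sigma> X) X (rips_cocone X) Y m H"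
    then obtain h where h: "controlled X Y h" "H = close_class X Y h"
      unfolding cocone_morphism_def by (meson coarse_homE)
    \<comment> \<open>The leg at scale 0 already determines \<open>H\<close>, since closeness on
      \<open>Rips 0 X\<close> is closeness on \<open>X\<close>.\<close>
    from H have "coarse_comp (Rips 0 X) Y H (rips_cocone X 0) = m 0"
      unfolding cocone_morphism_def by blast
    then show "H = close_class X Y (g 0)"
      using h controlled_maps[OF h(1)]
      by (simp add: mg coarse_comp_rips_cocone close_class_iff close_class_eq_iff gY)
  qed
qed

section \<open>Uniqueness of colimits up to isomorphism\<close>

lemma cocone_morphism_id:
  "cocone D t L l \<Longrightarrow> cocone_morphism D L l L l (coarse_id L)"
  by (simp add: cocone_morphism_def cocone_def coarse_id_in_coarse_hom coarse_comp_id_left)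

text \<open>\<open>cocone_morphism\<close> does not record that the legs \<open>l \<sigma>\<close>
  are morphisms; the cocone assumption supplies this for associativity.\<close>

lemma cocone_morphism_comp:
  assumes "cocone D t L l"
    and "cocone_morphism D L l M m H" "cocone_morphism D M m N n K"
  shows "cocone_morphism D L l N n (coarse_comp L N K H)"
proof -
  have "coarse_comp (D \<sigma>) N (coarse_comp L N K H) (l \<sigma>) = n \<sigma>" if "\<sigma> \<ge> 0" for \<sigma>
    using assms that coarse_comp_assoc[of "l \<sigma>" "D \<sigma>" L H M K N]
    unfolding cocone_def cocone_morphism_def by simp
  then show ?thesis
    using assms coarse_comp_in_coarse_hom unfolding cocone_morphism_def by blast
qed

lemma colimit_cocone_cocone: "colimit_cocone TYPE('d) D t L l \<Longrightarrow> cocone D t L l"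
  by (simp add: colimit_cocone_def)

lemma colimit_cocone_ex1:
  fixes Y :: "'d emetric"
  shows "colimit_cocone TYPE('d) D t L l \<Longrightarrow> cocone D t Y m \<Longrightarrow> \<exists>!H. cocone_morphism D L l Y m H"
  by (simp add: colimit_cocone_def)

text \<open>The inverse \<open>G\<close> comes from the universal property of \<open>M\<close>
  tested on \<open>L\<close>. Each composite and the identity are cocone endomorphisms of the same
  colimit, hence equal. Testing \<open>L\<close> on itself and \<open>M\<close> on both
  \<open>L\<close> and \<open>M\<close> accounts for the three type instances.\<close>

lemma coarse_iso_colimit_cocones:
  fixes L :: "'c emetric" and M :: "'d emetric"
  assumes L: "colimit_cocone TYPE('c) D t L l"
    and M: "colimit_cocone TYPE('c) D t M m" "colimit_cocone TYPE('d) D t M m"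
    and H: "cocone_morphism D L l M m H"
  shows "coarse_iso L M H"
proof -
  note cocones = colimit_cocone_cocone[OF L] colimit_cocone_cocone[OF M(1)]
  obtain G where G: "cocone_morphism D M m L l G"
    using colimit_cocone_ex1[OF M(1) cocones(1)] by blast
  have "coarse_comp L L G H = coarse_id L"
    using colimit_cocone_ex1[OF L cocones(1)] cocone_morphism_id[OF cocones(1)]
      cocone_morphism_comp[OF cocones(1) H G] by blast
  moreover have "coarse_comp M M H G = coarse_id M"
    using colimit_cocone_ex1[OF M(2) cocones(2)] cocone_morphism_id[OF cocones(2)]
      cocone_morphism_comp[OF cocones(2) G H] by blast
  ultimately show ?thesis
    using G H unfolding coarse_iso_def cocone_morphism_def by blast
qed

text \<open>For another colimit \<open>L\<close>, test objects over \<open>'a\<close> induce the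
  morphism to \<open>X\<close>, and those over \<open>'c\<close> identify the composite from
  \<open>L\<close> to itself with the identity.\<close>

theorem theorem1p1:
  fixes X :: "'a emetric"
  shows "colimit_cocone TYPE('b) (\<lambda>\<sigma>. Rips \<sigma> X) (rips_transition X) X (rips_cocone X) \<and>
    (\<forall>(L :: 'c emetric) l.
       colimit_cocone TYPE('a) (\<lambda>\<sigma>. Rips \<sigma> X) (rips_transition X) L l \<and>
       colimit_cocone TYPE('c) (\<lambda>\<sigma>. Rips \<sigma> X) (rips_transition X) L l \<longrightarrow>
       (\<exists>!H. cocone_morphism (\<lambda>\<sigma>. Rips \<sigma> X) L l X (rips_cocone X) H) \<and>
       (\<forall>H. cocone_morphism (\<lambda>\<sigma>. Rips \<sigma> X) L l X (rips_cocone X) H \<longrightarrow> coarse_iso L X H))"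
  using colimit_cocone_rips_cocone colimit_cocone_ex1[OF _ cocone_rips_cocone]
    coarse_iso_colimit_cocones[OF _ colimit_cocone_rips_cocone colimit_cocone_rips_cocone]
  by blast

end
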